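(* Let $\mathcal{H}(z)=\sum_{n\ge 0} |\mathcal{S}_n\cap Av(\mathbf{4123},\mathbf{1324},\mathbf{31524})|\, z^n$ be the generating function for the permutation class $Av(\mathbf{4123},\mathbf{1324},\mathbf{31524})$. Then $$\mathcal{H}(z) = \frac{3-22z+54z^2-54z^3+25z^4-4z^5-(1-6z+14z^2-16z^3+5z^4)\sqrt{1-4z}}{2\sqrt{1-4z}\,(1-3z+z^2)^2}.$$
   Context: A permutation $\sigma$ contains a pattern $\pi$ if some subsequence of $\sigma$ is order-isomorphic to $\pi$; otherwise $\sigma$ avoids $\pi$. For a set $B$ of patterns, $Av(B)$ is the set of permutations avoiding every element of $B$, and $\mathcal{S}_n$ is the set of permutations of length $n$ (the empty permutation is counted for $n=0$). *)

theory Defs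
  imports
    Complex_Main
    "HOL-Library.Sublist"
    "HOL-Combinatorics.Multiset_Permutations"
    "HOL-Computational_Algebra.Formal_Power_Series"
begin

text \<open>Permutations of length n are written in one-line notation, as lists that contain
  each of 1, ..., n exactly once.\<close>

definition Sym :: "nat \<Rightarrow> nat list set" where
  "Sym n = permutations_of_set {1..n}"

definition order_isomorphic :: "nat list \<Rightarrow> nat list \<Rightarrow> bool" where
  "order_isomorphic xs ys \<longleftrightarrow>
     length xs = length ys \<and>
     (\<forall>i < length xs. \<forall>j < length xs. xs ! i < xs ! j \<longleftrightarrow> ys ! i < ys ! j)"

text \<open>The library predicate \<open>subseq\<close> is about not necessarily contiguous subsequences.\<close>

definition contains_pattern :: "nat list \<Rightarrow> nat list \<Rightarrow> bool" where
  "contains_pattern \<sigma> \<pi> \<longleftrightarrow> (\<exists>\<tau>. subseq \<tau> \<sigma> \<and> order_isomorphic \<tau> \<pi>)"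

definition Av :: "nat list set \<Rightarrow> nat list set" where
  "Av B = {\<sigma> \<in> (\<Union>n. Sym n). \<forall>\<pi>\<in>B. \<not> contains_pattern \<sigma> \<pi>}"

definition class_gf :: "nat list set \<Rightarrow> real fps" where
  "class_gf C = Abs_fps (\<lambda>n. of_nat (card (Sym n \<inter> C)))"

text \<open>The formal square root; for a series with positive constant coefficient \<open>c\<close> this is the
  root with constant coefficient \<open>sqrt c\<close>.\<close>

definition fps_sqrt :: "real fps \<Rightarrow> real fps" where
  "fps_sqrt f = fps_radical root 2 f"

end

(* Build permutations by appending last entries, where appending at the gap g gives the new entry
   the value g + 1.  A gap is a site if this stays in the class.  After appending at a site g > 0,
   all sites up to g survive, and above the new entry at most one site remains: the gap just above
   it if the permutation splits as a direct sum at g, and the topmost gap if the permutation splits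
   as a skew sum at g and the topmost gap was a site.  After appending at g = 0 all gaps that were
   sites remain so.  Hence the number of sites, together with the ranks of the sites at which the
   permutation splits, determines the whole tree of extensions.  Only four families of such states
   occur; the generating functions of their subtrees solve a linear recurrence whose solution is a
   combination of powers of the Catalan series c = 1 + z c^2 and of (1 - z) / (1 - 2 z). *)

theory Submission
  imports Defs
begin

section \<open>Extending a permutation by a last entry\<close>

text \<open>The order embedding whose image misses exactly \<open>Suc g\<close>, which frees that
  value for the new last entry.\<close>

definition raise :: "nat \<Rightarrow> nat \<Rightarrow> nat" where
  "raise g x = (if g < x then Suc x else x)"

definition app :: "nat list \<Rightarrow> nat \<Rightarrow> nat list" where
  "app s g = map (raise g) s @ [Suc g]"

text \<open>The three conjuncts forbid what is left of 4123, 1324 and 31524 without their last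
  letter, in the positions where an entry placed in the gap \<open>g\<close> would supply
  it.\<close>

definition legal :: "nat list \<Rightarrow> nat \<Rightarrow> bool" where
  "legal s g \<longleftrightarrow>
     \<not> (\<exists>a b c. subseq [a, b, c] s \<and> b < c \<and> c \<le> g \<and> g < a) \<and>
     \<not> (\<exists>x z y. subseq [x, z, y] s \<and> x < y \<and> y < z \<and> z \<le> g) \<and>
     \<not> (\<exists>p x z y. subseq [p, x, z, y] s \<and> x < y \<and> y < p \<and> p \<le> g \<and> g < z)"

lemma raise_less_iff [simp]: "raise g x < raise g y \<longleftrightarrow> x < y"
  by (auto simp: raise_def)

lemma raise_eq_iff [simp]: "raise g x = raise g y \<longleftrightarrow> x = y"
  by (auto simp: raise_def)

lemma raise_less_Suc [simp]: "raise g x < Suc g \<longleftrightarrow> x \<le> g"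
  by (auto simp: raise_def)

lemma Suc_less_raise [simp]: "Suc g < raise g x \<longleftrightarrow> g < x"
  by (auto simp: raise_def)

section \<open>Subsequences of an extended permutation\<close>

lemma subseq_singleton_right: "subseq xs [y] \<longleftrightarrow> xs = [] \<or> xs = [y]"
  by (cases xs) (auto simp: list_emb_Cons_iff2 split: if_splits)

lemma subseq_snoc_snoc:
  "subseq (xs @ [x]) (ys @ [y]) \<longleftrightarrow> x = y \<and> subseq xs ys \<or> subseq (xs @ [x]) ys"
  unfolding subseq_append_iff[of _ ys] subseq_singleton_right
  by auto

lemma subseq_map_iff: "subseq xs (map f ys) \<longleftrightarrow> (\<exists>zs. xs = map f zs \<and> subseq zs ys)"
proof
  assume "subseq xs (map f ys)"
  then obtain N where "xs = nths (map f ys) N"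
    by (auto simp: subseq_conv_nths)
  then show "\<exists>zs. xs = map f zs \<and> subseq zs ys"
    by (auto simp: nths_map subseq_conv_nths)
qed (auto intro: subseq_map)

lemma ex_Cons_eq_map_iff:
  "(\<exists>zs. x # xs = map f zs \<and> P zs) \<longleftrightarrow> (\<exists>x'. x = f x' \<and> (\<exists>zs. xs = map f zs \<and> P (x' # zs)))"
  by (auto simp: Cons_eq_map_conv)

lemma subseq3_app:
  "subseq [x, y, z] (app s g) \<longleftrightarrow>
     z = Suc g \<and> (\<exists>x' y'. x = raise g x' \<and> y = raise g y' \<and> subseq [x', y'] s) \<or>
     (\<exists>x' y' z'. x = raise g x' \<and> y = raise g y' \<and> z = raise g z' \<and> subseq [x', y', z'] s)"
  using subseq_snoc_snoc[of "[x, y]" z "map (raise g) s" "Suc g"]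
  by (simp add: app_def subseq_map_iff ex_Cons_eq_map_iff subseq_singleton_left)

lemma subseq2_app:
  "subseq [x, y] (app s g) \<longleftrightarrow>
     y = Suc g \<and> (\<exists>x'. x = raise g x' \<and> x' \<in> set s) \<or>
     (\<exists>x' y'. x = raise g x' \<and> y = raise g y' \<and> subseq [x', y'] s)"
  using subseq_snoc_snoc[of "[x]" y "map (raise g) s" "Suc g"]
  by (simp add: app_def subseq_map_iff ex_Cons_eq_map_iff subseq_singleton_left)

lemma subseq4_app:
  "subseq [x, y, z, u] (app s g) \<longleftrightarrow>
     u = Suc g \<and> (\<exists>x' y' z'. x = raise g x' \<and> y = raise g y' \<and> z = raise g z' \<and> subseq [x', y', z'] s) \<or>
     (\<exists>x' y' z' u'. x = raise g x' \<and> y = raise g y' \<and> z = raise g z' \<and> u = raise g u' \<and>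
        subseq [x', y', z', u'] s)"
  using subseq_snoc_snoc[of "[x, y, z]" u "map (raise g) s" "Suc g"]
  by (simp add: app_def subseq_map_iff ex_Cons_eq_map_iff subseq_singleton_left)

lemma subseq5_app:
  "subseq [x, y, z, u, w] (app s g) \<longleftrightarrow>
     w = Suc g \<and> (\<exists>x' y' z' u'. x = raise g x' \<and> y = raise g y' \<and> z = raise g z' \<and> u = raise g u' \<and>
        subseq [x', y', z', u'] s) \<or>
     (\<exists>x' y' z' u' w'. x = raise g x' \<and> y = raise g y' \<and> z = raise g z' \<and> u = raise g u' \<and>
        w = raise g w' \<and> subseq [x', y', z', u', w'] s)"
  using subseq_snoc_snoc[of "[x, y, z, u]" w "map (raise g) s" "Suc g"]
  by (simp add: app_def subseq_map_iff ex_Cons_eq_map_iff subseq_singleton_left)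

section \<open>The three patterns as chains of inequalities\<close>

lemma contains_pattern_iff_4:
  assumes "length \<pi> = 4" "\<And>a b c d. order_isomorphic [a,b,c,d] \<pi> \<longleftrightarrow> R a b c d"
  shows "contains_pattern s \<pi> \<longleftrightarrow> (\<exists>a b c d. subseq [a,b,c,d] s \<and> R a b c d)"
proof
  assume "contains_pattern s \<pi>"
  then obtain t where t: "subseq t s" "order_isomorphic t \<pi>"
    unfolding contains_pattern_def by blast
  then have "length t = 4"
    using assms(1) unfolding order_isomorphic_def by simp
  then obtain a b c d where "t = [a,b,c,d]"
    by (auto simp: numeral_eq_Suc length_Suc_conv)
  with t assms(2) show "\<exists>a b c d. subseq [a,b,c,d] s \<and> R a b c d"
    by metis
next
  assume "\<exists>a b c d. subseq [a,b,c,d] s \<and> R a b c d"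
  with assms(2) show "contains_pattern s \<pi>"
    unfolding contains_pattern_def by metis
qed

lemma contains_pattern_iff_5:
  assumes "length \<pi> = 5" "\<And>a b c d e. order_isomorphic [a,b,c,d,e] \<pi> \<longleftrightarrow> R a b c d e"
  shows "contains_pattern s \<pi> \<longleftrightarrow> (\<exists>a b c d e. subseq [a,b,c,d,e] s \<and> R a b c d e)"
proof
  assume "contains_pattern s \<pi>"
  then obtain t where t: "subseq t s" "order_isomorphic t \<pi>"
    unfolding contains_pattern_def by blast
  then have "length t = 5"
    using assms(1) unfolding order_isomorphic_def by simp
  then obtain a b c d e where "t = [a,b,c,d,e]"
    by (auto simp: numeral_eq_Suc length_Suc_conv)
  with t assms(2) show "\<exists>a b c d e. subseq [a,b,c,d,e] s \<and> R a b c d e"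
    by metis
next
  assume "\<exists>a b c d e. subseq [a,b,c,d,e] s \<and> R a b c d e"
  with assms(2) show "contains_pattern s \<pi>"
    unfolding contains_pattern_def by metis
qed

lemma contains_4123_iff:
  "contains_pattern s [4,1,2,3] \<longleftrightarrow> (\<exists>a b c d. subseq [a,b,c,d] s \<and> b < c \<and> c < d \<and> d < a)"
  by (rule contains_pattern_iff_4) (simp, simp add: order_isomorphic_def All_less_Suc, linarith)

lemma contains_1324_iff:
  "contains_pattern s [1,3,2,4] \<longleftrightarrow> (\<exists>a b c d. subseq [a,b,c,d] s \<and> a < c \<and> c < b \<and> b < d)"
  by (rule contains_pattern_iff_4) (simp, simp add: order_isomorphic_def All_less_Suc, linarith)

lemma contains_31524_iff:
  "contains_pattern s [3,1,5,2,4] \<longleftrightarrow>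
     (\<exists>a b c d e. subseq [a,b,c,d,e] s \<and> b < d \<and> d < a \<and> a < e \<and> e < c)"
  by (rule contains_pattern_iff_5) (simp, simp add: order_isomorphic_def All_less_Suc, linarith)

text \<open>The new entry comes last, so an occurrence either uses it as its last letter or lies in
  \<open>s\<close>. With \<open>R\<close> arbitrary this serves both the patterns and the conditions
  of \<open>legal\<close>.\<close>

lemma ex_subseq4_app:
  "(\<exists>x y z u. subseq [x, y, z, u] (app s g) \<and> R x y z u) \<longleftrightarrow>
     (\<exists>x y z u. subseq [x, y, z, u] s \<and> R (raise g x) (raise g y) (raise g z) (raise g u)) \<or>
     (\<exists>x y z. subseq [x, y, z] s \<and> R (raise g x) (raise g y) (raise g z) (Suc g))"
  (is "?L \<longleftrightarrow> ?R1 \<or> ?R2")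
proof
  assume ?L
  then obtain x y z u where *: "subseq [x, y, z, u] (app s g)" "R x y z u"
    by blast
  from *(1)[unfolded subseq4_app] show "?R1 \<or> ?R2"
    using *(2) by (elim disjE exE conjE) (hypsubst, blast)+
next
  assume "?R1 \<or> ?R2"
  then show ?L
  proof
    assume ?R1
    then obtain x y z u where "subseq [x, y, z, u] s" "R (raise g x) (raise g y) (raise g z) (raise g u)"
      by blast
    moreover from this(1) have "subseq [raise g x, raise g y, raise g z, raise g u] (app s g)"
      unfolding subseq4_app by blast
    ultimately show ?L by blast
  next
    assume ?R2
    then obtain x y z where "subseq [x, y, z] s" "R (raise g x) (raise g y) (raise g z) (Suc g)"
      by blast
    moreover from this(1) have "subseq [raise g x, raise g y, raise g z, Suc g] (app s g)"
      unfolding subseq4_app by blast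
    ultimately show ?L by blast
  qed
qed

lemma ex_subseq5_app:
  "(\<exists>x y z u w. subseq [x, y, z, u, w] (app s g) \<and> R x y z u w) \<longleftrightarrow>
     (\<exists>x y z u w. subseq [x, y, z, u, w] s \<and>
        R (raise g x) (raise g y) (raise g z) (raise g u) (raise g w)) \<or>
     (\<exists>x y z u. subseq [x, y, z, u] s \<and>
        R (raise g x) (raise g y) (raise g z) (raise g u) (Suc g))"
  (is "?L \<longleftrightarrow> ?R1 \<or> ?R2")
proof
  assume ?L
  then obtain x y z u w where *: "subseq [x, y, z, u, w] (app s g)" "R x y z u w"
    by blast
  from *(1)[unfolded subseq5_app] show "?R1 \<or> ?R2"
    using *(2) by (elim disjE exE conjE) (hypsubst, blast)+
next
  assume "?R1 \<or> ?R2"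
  then show ?L
  proof
    assume ?R1
    then obtain x y z u w where "subseq [x, y, z, u, w] s"
      "R (raise g x) (raise g y) (raise g z) (raise g u) (raise g w)"
      by blast
    moreover from this(1) have "subseq [raise g x, raise g y, raise g z, raise g u, raise g w] (app s g)"
      unfolding subseq5_app by blast
    ultimately show ?L by blast
  next
    assume ?R2
    then obtain x y z u where "subseq [x, y, z, u] s" "R (raise g x) (raise g y) (raise g z) (raise g u) (Suc g)"
      by blast
    moreover from this(1) have "subseq [raise g x, raise g y, raise g z, raise g u, Suc g] (app s g)"
      unfolding subseq5_app by blast
    ultimately show ?L by blast
  qed
qed

abbreviation basis :: "nat list set" where
  "basis \<equiv> {[4,1,2,3], [1,3,2,4], [3,1,5,2,4]}"

definition avoids :: "nat list \<Rightarrow> bool" where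
  "avoids s \<longleftrightarrow> (\<forall>\<pi>\<in>basis. \<not> contains_pattern s \<pi>)"

text \<open>Old occurrences survive because \<open>raise g\<close> preserves order; new ones end in
  the new entry and are those that \<open>legal\<close> excludes.\<close>

lemma avoids_app: "avoids (app s g) \<longleftrightarrow> avoids s \<and> legal s g"
proof -
  have 1: "contains_pattern (app s g) [4,1,2,3] \<longleftrightarrow> contains_pattern s [4,1,2,3] \<or>
      (\<exists>a b c. subseq [a, b, c] s \<and> b < c \<and> c \<le> g \<and> g < a)"
    unfolding contains_4123_iff ex_subseq4_app by simp
  have 2: "contains_pattern (app s g) [1,3,2,4] \<longleftrightarrow> contains_pattern s [1,3,2,4] \<or>
      (\<exists>x z y. subseq [x, z, y] s \<and> x < y \<and> y < z \<and> z \<le> g)"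
    unfolding contains_1324_iff ex_subseq4_app by simp
  have 3: "contains_pattern (app s g) [3,1,5,2,4] \<longleftrightarrow> contains_pattern s [3,1,5,2,4] \<or>
      (\<exists>p x z y. subseq [p, x, z, y] s \<and> x < y \<and> y < p \<and> p \<le> g \<and> g < z)"
    unfolding contains_31524_iff ex_subseq5_app by simp
  show ?thesis
    by (simp only: avoids_def legal_def ball_simps 1 2 3 de_Morgan_disj conj_ac simp_thms)
qed

section \<open>Admissible gaps after an extension\<close>

definition perm :: "nat list \<Rightarrow> bool" where
  "perm s \<longleftrightarrow> distinct s \<and> set s = {1..length s}"

definition sites :: "nat list \<Rightarrow> nat set" where
  "sites s = {g. g \<le> length s \<and> legal s g}"

text \<open>Direct sum decomposition at the value \<open>g\<close>. The end
  \<open>g = length s\<close> counts, because the gap above an appended maximum remains a site;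
  appending at 0 is treated separately.\<close>

definition sum_cut :: "nat list \<Rightarrow> nat \<Rightarrow> bool" where
  "sum_cut s g \<longleftrightarrow> 0 < g \<and> g \<le> length s \<and> \<not> (\<exists>x y. subseq [x, y] s \<and> g < x \<and> y \<le> g)"

text \<open>Skew decomposition, larger values first. With \<open>g = length s\<close> excluded, no
  gap of a permutation is a cut of both kinds.\<close>

definition skew_cut :: "nat list \<Rightarrow> nat \<Rightarrow> bool" where
  "skew_cut s g \<longleftrightarrow> 0 < g \<and> g < length s \<and> \<not> (\<exists>x y. subseq [x, y] s \<and> x \<le> g \<and> g < y)"

section \<open>Every nonempty permutation as a unique extension\<close>

lemma Sym_eq: "Sym n = {s. perm s \<and> length s = n}"
  unfolding Sym_def permutations_of_set_def perm_def
  using distinct_card by fastforce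

lemma length_app [simp]: "length (app s g) = Suc (length s)"
  by (simp add: app_def)

lemma raise_image_Un: "g \<le> n \<Longrightarrow> insert (Suc g) (raise g ` {1..n}) = {1..Suc n}"
proof (intro equalityI subsetI)
  fix x assume "g \<le> n" "x \<in> {1..Suc n}"
  then show "x \<in> insert (Suc g) (raise g ` {1..n})"
    by (cases "x \<le> g"; cases "x = Suc g")
      (auto simp: raise_def image_iff intro!: bexI[of _ "if x \<le> g then x else x - 1"])
qed (auto simp: raise_def)

lemma perm_app: "perm s \<Longrightarrow> g \<le> length s \<Longrightarrow> perm (app s g)"
  using raise_image_Un[of g "length s"]
  by (auto simp: perm_def app_def distinct_map inj_on_def raise_def)

lemma app_inject:
  assumes "app s g = app s' g'" shows "s = s' \<and> g = g'"
proof -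
  from assms have "g = g'" "map (raise g) s = map (raise g) s'"
    by (auto simp: app_def)
  moreover have "inj (raise g)"
    by (auto simp: inj_def)
  ultimately show ?thesis
    by (simp add: inj_map_eq_map)
qed

text \<open>Deleting the last entry \<open>c\<close> and closing the hole with \<open>low\<close>
  undoes \<open>app\<close> at the gap \<open>c - 1\<close>.\<close>

lemma perm_eq_app:
  assumes "perm t" "length t = Suc n"
  obtains s g where "perm s" "length s = n" "g \<le> n" "t = app s g"
proof -
  from assms(2) obtain t' c where t: "t = t' @ [c]"
    by (metis length_Suc_conv_rev)
  from assms t have len: "length t' = n" and t': "distinct t'" "c \<notin> set t'" "c \<in> {1..Suc n}"
    and set: "set t' \<subseteq> {1..Suc n}"
    by (auto simp: perm_def)
  define low where "low x = (if x > c then x - 1 else x)" for x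
  define s where "s = map low t'"
  have raise_low: "raise (c - 1) (low x) = x" if "x \<in> set t'" for x
  proof -
    have "x \<noteq> c" using that t' by auto
    then show ?thesis using t' by (auto simp: raise_def low_def)
  qed
  have map: "map (raise (c - 1)) s = t'"
    unfolding s_def using raise_low by (simp add: map_idI)
  have len_s: "length s = n"
    using len by (simp add: s_def)
  have dist: "distinct s"
    using t'(1) map by (metis distinct_map)
  have "set s \<subseteq> {1..n}"
  proof
    fix y assume "y \<in> set s"
    then obtain x where "x \<in> set t'" "y = low x" by (auto simp: s_def)
    moreover from this have "x \<noteq> c" "x \<in> {1..Suc n}" using set t'(2) by auto
    ultimately show "y \<in> {1..n}" using t'(3) by (auto simp: low_def)
  qed
  then have "set s = {1..n}"
    using distinct_card[OF dist] len_s by (intro card_subset_eq) simp_all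
  then have "perm s" "length s = n"
    using dist len_s by (auto simp: perm_def)
  moreover have "c - 1 \<le> n" "t = app s (c - 1)"
    unfolding app_def map using t' t by auto
  ultimately show ?thesis using that by blast
qed

lemma subseq_imp_set_subset: "subseq xs ys \<Longrightarrow> set xs \<subseteq> set ys"
  by (auto simp: subseq_conv_nths dest: in_set_nthsD)

lemma perm_mem_iff: "perm s \<Longrightarrow> x \<in> set s \<longleftrightarrow> 0 < x \<and> x \<le> length s"
  by (auto simp: perm_def)

lemma perm_subseq2:
  assumes "perm s" "subseq [x, y] s"
  shows "0 < x" "x \<le> length s" "0 < y" "y \<le> length s"
  using subseq_imp_set_subset[OF assms(2)] perm_mem_iff[OF assms(1)] by auto

lemma perm_subseq3:
  assumes "perm s" "subseq [x, y, z] s"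
  shows "0 < x" "x \<le> length s" "0 < y" "y \<le> length s" "0 < z" "z \<le> length s"
  using subseq_imp_set_subset[OF assms(2)] perm_mem_iff[OF assms(1)] by auto

lemma perm_subseq4:
  assumes "perm s" "subseq [x, y, z, u] s"
  shows "0 < x" "0 < y" "0 < z" "0 < u"
  using subseq_imp_set_subset[OF assms(2)] perm_mem_iff[OF assms(1)] by auto

lemma subseq2_total:
  "x \<in> set s \<Longrightarrow> y \<in> set s \<Longrightarrow> x \<noteq> y \<Longrightarrow> subseq [x, y] s \<or> subseq [y, x] s"
  by (induction s) (auto simp: subseq_singleton_left)

text \<open>Distinctness forces both occurrences of \<open>x\<close> into the same position.\<close>

lemma subseq_glue:
  "distinct s \<Longrightarrow> subseq [p, x] s \<Longrightarrow> subseq [x, z] s \<Longrightarrow> subseq [p, x, z] s"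
  by (induction s)
    (auto simp: subseq_singleton_left split: if_splits dest: subseq_imp_set_subset)

lemma ex_subseq3_app:
  "(\<exists>x y z. subseq [x, y, z] (app s g) \<and> R x y z) \<longleftrightarrow>
     (\<exists>x y z. subseq [x, y, z] s \<and> R (raise g x) (raise g y) (raise g z)) \<or>
     (\<exists>x y. subseq [x, y] s \<and> R (raise g x) (raise g y) (Suc g))"
  unfolding subseq3_app
  apply (rule iffI)
   apply (elim exE conjE disjE; hypsubst; blast)
  apply (elim exE conjE disjE; blast)
  done

lemma ex_subseq2_app:
  "(\<exists>x y. subseq [x, y] (app s g) \<and> R x y) \<longleftrightarrow>
     (\<exists>x y. subseq [x, y] s \<and> R (raise g x) (raise g y)) \<or>
     (\<exists>x \<in> set s. R (raise g x) (Suc g))"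
  unfolding subseq2_app
  apply (rule iffI)
   apply (elim exE conjE disjE; hypsubst; blast)
  apply (elim exE conjE disjE bexE; blast)
  done

section \<open>Gaps below and above the new last entry\<close>

lemma raise_le_low: "h \<le> g \<Longrightarrow> raise g x \<le> h \<longleftrightarrow> x \<le> h"
  by (auto simp: raise_def)

lemma less_raise_low: "h \<le> g \<Longrightarrow> h < raise g x \<longleftrightarrow> h < x"
  by (auto simp: raise_def)

lemma raise_le_high: "g \<le> h \<Longrightarrow> raise g x \<le> Suc h \<longleftrightarrow> x \<le> h"
  by (auto simp: raise_def)

lemma less_raise_high: "g \<le> h \<Longrightarrow> Suc h < raise g x \<longleftrightarrow> h < x"
  by (auto simp: raise_def)

text \<open>In every clause of \<open>legal\<close> the last letter lies below the gap, whereas the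
  new entry lies above \<open>h\<close>.\<close>

lemma legal_app_low: "h \<le> g \<Longrightarrow> legal (app s g) h \<longleftrightarrow> legal s h"
  unfolding legal_def ex_subseq3_app ex_subseq4_app
  by (auto simp: raise_le_low less_raise_low)

text \<open>Gaps from \<open>g\<close> on move up by one, so \<open>Suc h\<close> is the old gap
  \<open>h\<close>. The three added conditions are the clauses of \<open>legal\<close> with the new
  entry as last letter.\<close>

lemma legal_app_high:
  assumes "g \<le> h"
  shows "legal (app s g) (Suc h) \<longleftrightarrow> legal s h \<and>
     \<not> (\<exists>a b. subseq [a, b] s \<and> b \<le> g \<and> h < a) \<and>
     \<not> (\<exists>x z. subseq [x, z] s \<and> x \<le> g \<and> g < z \<and> z \<le> h) \<and>
     \<not> (\<exists>p x z. subseq [p, x, z] s \<and> x \<le> g \<and> g < p \<and> p \<le> h \<and> h < z)"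
  using assms unfolding legal_def ex_subseq3_app ex_subseq4_app
  by (simp add: raise_le_high less_raise_high de_Morgan_disj conj_ac)

lemma legal_0:
  assumes "perm s" shows "legal s 0"
  using perm_subseq3[OF assms] perm_subseq4[OF assms] unfolding legal_def by blast

text \<open>For \<open>g = 0\<close> each condition added in \<open>legal_app_high\<close> asks for
  an entry of value at most 0.\<close>

lemma sites_app_0:
  assumes "perm s"
  shows "sites (app s 0) = insert 0 (Suc ` sites s)"
proof -
  have "\<not> subseq [x, 0] s" "\<not> subseq [0, y] s" "\<not> subseq [x, 0, y] s" for x y
    using perm_subseq2[OF assms] perm_subseq3[OF assms] by blast+
  then have "legal (app s 0) (Suc h) \<longleftrightarrow> legal s h" for h
    by (simp add: legal_app_high)
  moreover have "legal (app s 0) 0"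
    using perm_app[OF assms] by (intro legal_0) simp
  ultimately have "h \<in> sites (app s 0) \<longleftrightarrow> h \<in> insert 0 (Suc ` sites s)" for h
    by (cases h) (auto simp: sites_def)
  then show ?thesis by blast
qed

text \<open>A gap above the new last entry stays open only if no pattern is completed by it; with
  entries on both sides of the gap \<open>g\<close> this leaves just the boundary gap of a decomposition at \<open>g\<close>.\<close>

lemma high_gap_open_iff:
  assumes "perm s" "0 < g" "g \<le> h" "h \<le> length s"
  shows "\<not> (\<exists>a b. subseq [a, b] s \<and> b \<le> g \<and> h < a) \<and>
     \<not> (\<exists>x z. subseq [x, z] s \<and> x \<le> g \<and> g < z \<and> z \<le> h) \<and>
     \<not> (\<exists>p x z. subseq [p, x, z] s \<and> x \<le> g \<and> g < p \<and> p \<le> h \<and> h < z) \<longleftrightarrow>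
     h = g \<and> sum_cut s g \<or> h = length s \<and> skew_cut s g"
    (is "\<not> ?B1 \<and> \<not> ?B2 \<and> \<not> ?B3 \<longleftrightarrow> ?R")
proof
  assume B: "\<not> ?B1 \<and> \<not> ?B2 \<and> \<not> ?B3"
  consider "h = g" | "g < h" "h = length s" | "g < h" "h < length s"
    using assms by linarith
  then show ?R
  proof cases
    case 1
    with B assms show ?thesis by (auto simp: sum_cut_def)
  next
    case 2
    have "\<not> (\<exists>x y. subseq [x, y] s \<and> x \<le> g \<and> g < y)"
      using B perm_subseq2(4)[OF assms(1)] unfolding 2(2) by blast
    with 2 assms show ?thesis by (simp add: skew_cut_def)
  next
    case 3
    \<comment> \<open>For \<open>h\<close> strictly between \<open>g\<close> and the top, look at
      the entries 1, \<open>h\<close> and \<open>length s\<close>: the first two conditions force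
      \<open>h\<close> before 1 and 1 before \<open>length s\<close>, and these three together
      violate the third.\<close>
    have mem: "h \<in> set s" "1 \<in> set s" "length s \<in> set s"
      using 3 assms by (auto simp: perm_mem_iff)
    have g: "1 \<le> g" using assms by simp
    then have "\<not> subseq [1, h] s" "\<not> subseq [length s, 1] s"
      using B 3 by blast+
    then have "subseq [h, 1] s" "subseq [1, length s] s"
      using subseq2_total[OF mem(1,2)] subseq2_total[OF mem(2,3)] 3 assms by auto
    then have "subseq [h, 1, length s] s"
      using assms(1) by (intro subseq_glue) (auto simp: perm_def)
    with g show ?thesis using B 3 by blast
  qed
next
  assume ?R
  then show "\<not> ?B1 \<and> \<not> ?B2 \<and> \<not> ?B3"
  proof (elim disjE conjE)
    assume "h = g" "sum_cut s g"
    then show ?thesis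
      by (simp add: sum_cut_def) (meson leD)
  next
    assume h: "h = length s" and "skew_cut s g"
    then have "\<not> ?B2"
      unfolding skew_cut_def by blast
    moreover have "\<not> ?B1" "\<not> ?B3"
      using perm_subseq2(2)[OF assms(1)] perm_subseq3(6)[OF assms(1)] leD unfolding h by blast+
    ultimately show ?thesis by simp
  qed
qed

text \<open>Sites up to \<open>g\<close> persist by \<open>legal_app_low\<close>. Above,
  \<open>high_gap_open_iff\<close> leaves only the old gap \<open>g\<close>, now
  \<open>Suc g\<close>, and the old topmost gap, now \<open>Suc (length s)\<close>.\<close>

lemma sites_app_pos:
  assumes "perm s" "0 < g" "g \<in> sites s"
  shows "sites (app s g) = {h \<in> sites s. h \<le> g} \<union> (if sum_cut s g then {Suc g} else {}) \<union>
           (if skew_cut s g \<and> length s \<in> sites s then {Suc (length s)} else {})"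
    (is "_ = ?R")
proof -
  have "h \<in> sites (app s g) \<longleftrightarrow> h \<in> ?R" for h
  proof (cases "h \<le> g")
    case True
    with assms show ?thesis by (auto simp: sites_def legal_app_low)
  next
    case False
    then obtain h' where h: "h = Suc h'" "g \<le> h'"
      by (cases h) auto
    have "h \<in> sites (app s g) \<longleftrightarrow> h' \<le> length s \<and> legal s h' \<and>
        (h' = g \<and> sum_cut s g \<or> h' = length s \<and> skew_cut s g)"
      unfolding h(1) sites_def mem_Collect_eq length_app legal_app_high[OF h(2)] Suc_le_mono
      using high_gap_open_iff[OF assms(1,2) h(2)] by blast
    then show ?thesis
      using assms(3) h False by (auto simp: sites_def)
  qed
  then show ?thesis by blast
qed

text \<open>For a cut above the new entry, that entry belongs to the lower part and comes last, so
  nothing may lie above the cut.\<close>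

lemma sum_cut_app:
  assumes "perm s" "g \<le> length s"
  shows "sum_cut (app s g) h \<longleftrightarrow> h \<le> g \<and> sum_cut s h \<or> h = Suc (length s)"
proof (cases "h \<le> g")
  case True
  with assms show ?thesis
    unfolding sum_cut_def ex_subseq2_app by (auto simp: raise_le_low less_raise_low)
next
  case False
  then obtain h' where h: "h = Suc h'" "g \<le> h'"
    by (cases h) auto
  have "length s \<in> set s" if "h' < length s"
    using that by (simp add: perm_mem_iff[OF assms(1)] del: length_greater_0_conv)
  then have "(\<exists>x\<in>set s. h' < x) \<longleftrightarrow> h' < length s"
    using assms(1) by (auto simp: perm_mem_iff)
  moreover have "\<not> (\<exists>x y. subseq [x, y] s \<and> h' < x \<and> y \<le> h')" if "h' = length s"
    using perm_subseq2[OF assms(1)] that by force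
  ultimately show ?thesis
    using h(2) False unfolding sum_cut_def ex_subseq2_app h(1)
    by (auto simp: raise_le_high less_raise_high)
qed

text \<open>For a cut below the new entry, that entry belongs to the upper part but is preceded by
  1. A new minimum creates the cut 1.\<close>

lemma skew_cut_app:
  assumes "perm s" "g \<le> length s"
  shows "skew_cut (app s g) h \<longleftrightarrow>
    (\<exists>h'. h = Suc h' \<and> g \<le> h' \<and> skew_cut s h') \<or> g = 0 \<and> h = 1 \<and> s \<noteq> []"
proof (cases "h \<le> g")
  case True
  have "\<not> skew_cut (app s g) h"
  proof
    assume sc: "skew_cut (app s g) h"
    then have "0 < h" by (simp add: skew_cut_def)
    then have "1 \<in> set s" using True assms by (simp add: perm_mem_iff)
    moreover have "raise g 1 \<le> h" "h < Suc g"
      using True \<open>0 < h\<close> by (auto simp: raise_def)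
    ultimately show False
      using sc unfolding skew_cut_def ex_subseq2_app by blast
  qed
  with True show ?thesis by (auto simp: skew_cut_def)
next
  case False
  then obtain h' where h: "h = Suc h'" "g \<le> h'"
    by (cases h) auto
  have eq: "skew_cut (app s g) h \<longleftrightarrow>
      h' < length s \<and> \<not> (\<exists>x y. subseq [x, y] s \<and> x \<le> h' \<and> h' < y)"
    using h(2) unfolding skew_cut_def ex_subseq2_app h(1)
    by (simp add: raise_le_high less_raise_high)
  show ?thesis
  \<comment> \<open>At 0 the condition on pairs is vacuous although \<open>skew_cut s 0\<close> is
    false; this is the extra cut 1.\<close>
  proof (cases "h' = 0")
    case True
    with h have "g = 0" "h = 1" by auto
    moreover have "\<not> (\<exists>x y. subseq [x, y] s \<and> x \<le> h' \<and> h' < y)"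
      using True perm_subseq2(1)[OF assms(1)] by force
    ultimately show ?thesis
      unfolding eq using True by (simp add: skew_cut_def)
  next
    case False
    then have "skew_cut (app s g) h \<longleftrightarrow> skew_cut s h'"
      unfolding eq by (simp add: skew_cut_def)
    with h False show ?thesis by auto
  qed
qed

section \<open>States\<close>

definition avoiders :: "nat \<Rightarrow> nat list set" where
  "avoiders n = {s. perm s \<and> length s = n \<and> avoids s}"

lemma avoiders_eq: "Sym n \<inter> Av basis = avoiders n"
  by (auto simp: avoiders_def Av_def avoids_def Sym_eq)

lemma finite_avoiders [simp]: "finite (avoiders n)"
  unfolding avoiders_eq[symmetric] Sym_def by simp

lemma finite_sites [simp]: "finite (sites s)"
  by (rule finite_subset[of _ "{..length s}"]) (auto simp: sites_def)

lemma avoiders_Suc: "avoiders (Suc n) = (\<lambda>(s, g). app s g) ` (SIGMA s:avoiders n. sites s)"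
proof (intro equalityI subsetI)
  fix t assume "t \<in> avoiders (Suc n)"
  then have t: "perm t" "length t = Suc n" "avoids t"
    by (auto simp: avoiders_def)
  from t(1,2) obtain s g where "perm s" "length s = n" "g \<le> n" "t = app s g"
    by (rule perm_eq_app)
  with t(3) show "t \<in> (\<lambda>(s, g). app s g) ` (SIGMA s:avoiders n. sites s)"
    by (auto simp: avoiders_def sites_def avoids_app)
qed (auto simp: avoiders_def sites_def avoids_app perm_app)

text \<open>Descendants, not descents: nodes \<open>d\<close> levels below \<open>s\<close> in the
  generating tree.\<close>

fun desc :: "nat \<Rightarrow> nat list \<Rightarrow> nat" where
  "desc 0 s = 1"
| "desc (Suc d) s = (\<Sum>g\<in>sites s. desc d (app s g))"

lemma sum_desc_avoiders: "(\<Sum>s\<in>avoiders n. desc d s) = card (avoiders (n + d))"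
proof (induction d arbitrary: n)
  case (Suc d)
  have inj: "inj_on (\<lambda>(s, g). app s g) (SIGMA s:avoiders n. sites s)"
    by (auto simp: inj_on_def dest: app_inject)
  have "(\<Sum>s\<in>avoiders n. desc (Suc d) s) = (\<Sum>(s, g)\<in>(SIGMA s:avoiders n. sites s). desc d (app s g))"
    by (simp add: sum.Sigma)
  also have "\<dots> = (\<Sum>t\<in>avoiders (Suc n). desc d t)"
    unfolding avoiders_Suc sum.reindex[OF inj] by (simp add: case_prod_unfold)
  finally show ?case
    using Suc.IH[of "Suc n"] by simp
qed auto

text \<open>A state \<open>(k, S, T, t)\<close> of a permutation records the number \<open>k\<close> of its sites, the
  (1-based) ranks \<open>S\<close> and \<open>T\<close> of those sites that are sum cuts and skew cuts, and whether the topmost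
  gap is a site; \<open>T\<close> is irrelevant unless \<open>t\<close> holds.\<close>

type_synonym state = "nat \<times> nat set \<times> nat set \<times> bool"

text \<open>Rank 1 is the gap 0: all sites survive, skew cuts move up, gap 1 (rank 2) becomes a skew
  cut, and only the topmost gap is a sum cut. For \<open>j > 1\<close> the first \<open>j\<close>
  sites survive. A sum cut adds the site just above the new entry, a skew cut adds the topmost gap,
  which is then a sum cut. No skew cut remains among the sites.\<close>

fun step :: "state \<Rightarrow> nat \<Rightarrow> state" where
  "step (k, S, T, t) j =
    (if j = 1 then (Suc k, if t then {Suc k} else {}, if t then insert 2 (Suc ` T) else {}, t)
     else if j \<in> S then (Suc j, S \<inter> {..j} \<union> (if t \<and> j = k then {Suc j} else {}), {}, t \<and> j = k)
     else if t \<and> j \<in> T then (Suc j, insert (Suc j) (S \<inter> {..j}), {}, True)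
     else (j, S \<inter> {..j}, {}, False))"

fun count_desc :: "nat \<Rightarrow> state \<Rightarrow> nat" where
  "count_desc 0 st = 1"
| "count_desc (Suc d) st = (\<Sum>j=1..fst st. count_desc d (step st j))"

definition enumerates :: "(nat \<Rightarrow> nat) \<Rightarrow> nat \<Rightarrow> nat set \<Rightarrow> bool" where
  "enumerates e k A \<longleftrightarrow> strict_mono_on {1..k} e \<and> e ` {1..k} = A"

text \<open>The empty permutation is excluded because extending it creates no skew cut, contrary to
  the first branch of \<open>step\<close>.\<close>

fun has_state :: "nat list \<Rightarrow> state \<Rightarrow> bool" where
  "has_state s (k, S, T, t) \<longleftrightarrow> perm s \<and> s \<noteq> [] \<and> (\<exists>e. enumerates e k (sites s) \<and>
     S = {j\<in>{1..k}. sum_cut s (e j)} \<and> t = (length s \<in> sites s) \<and>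
     (t \<longrightarrow> T = {j\<in>{1..k}. skew_cut s (e j)}))"

section \<open>Increasing enumerations of the sites\<close>

lemma enumerates_less_iff:
  "enumerates e k A \<Longrightarrow> i \<in> {1..k} \<Longrightarrow> j \<in> {1..k} \<Longrightarrow> e i < e j \<longleftrightarrow> i < j"
  unfolding enumerates_def using strict_mono_on_less by blast

lemma enumerates_le_iff:
  "enumerates e k A \<Longrightarrow> i \<in> {1..k} \<Longrightarrow> j \<in> {1..k} \<Longrightarrow> e i \<le> e j \<longleftrightarrow> i \<le> j"
  unfolding enumerates_def using strict_mono_on_less_eq by blast

lemma enumerates_inj: "enumerates e k A \<Longrightarrow> inj_on e {1..k}"
  unfolding enumerates_def using strict_mono_on_imp_inj_on by blast

lemma enumeratesE:
  assumes "enumerates e k A" "a \<in> A"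
  obtains i where "i \<in> {1..k}" "e i = a"
  using assms unfolding enumerates_def by blast

lemma enumerates_restrict:
  assumes "enumerates e k A" "j \<in> {1..k}"
  shows "enumerates e j {h \<in> A. h \<le> e j}"
proof -
  have "e ` {1..j} = {h \<in> A. h \<le> e j}"
  proof (intro equalityI subsetI)
    fix h assume "h \<in> {h \<in> A. h \<le> e j}"
    then obtain i where "i \<in> {1..k}" "h = e i" "e i \<le> e j"
      using assms(1) by (auto simp: enumerates_def)
    then show "h \<in> e ` {1..j}"
      using enumerates_le_iff[OF assms(1)] assms(2) by auto
  next
    fix h assume "h \<in> e ` {1..j}"
    then show "h \<in> {h \<in> A. h \<le> e j}"
      using assms enumerates_le_iff[OF assms(1)] by (auto simp: enumerates_def)
  qed
  moreover have "strict_mono_on {1..j} e"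
    using assms by (auto simp: enumerates_def strict_mono_on_def)
  ultimately show ?thesis by (simp add: enumerates_def)
qed

lemma enumerates_extend:
  assumes "enumerates e j A" "\<And>a. a \<in> A \<Longrightarrow> a < x"
  shows "enumerates (e(Suc j := x)) (Suc j) (insert x A)"
proof -
  have less: "e i < x" if "i \<in> {1..j}" for i
    using assms that by (auto simp: enumerates_def)
  have "e(Suc j := x) ` {1..j} = e ` {1..j}"
    by (intro image_cong) auto
  moreover have "{1..Suc j} = insert (Suc j) {1..j}"
    by auto
  ultimately have "e(Suc j := x) ` {1..Suc j} = insert x A"
    using assms(1) by (simp only: image_insert fun_upd_same enumerates_def)
  moreover have "strict_mono_on {1..Suc j} (e(Suc j := x))"
  proof (rule strict_mono_onI)
    fix r s assume rs: "r \<in> {1..Suc j}" "s \<in> {1..Suc j}" "r < s"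
    then have "r \<in> {1..j}" by simp
    with rs less enumerates_less_iff[OF assms(1), of r s]
    show "(e(Suc j := x)) r < (e(Suc j := x)) s"
      by (cases "s = Suc j") auto
  qed
  ultimately show ?thesis by (simp add: enumerates_def)
qed

lemma enumerates_shift:
  assumes "enumerates e k A"
  shows "enumerates (\<lambda>i. if i \<le> 1 then 0 else Suc (e (i - 1))) (Suc k) (insert 0 (Suc ` A))"
proof -
  have "{1..Suc k} = insert 1 (Suc ` {1..k})"
    by (auto simp: image_iff)
  moreover have "(\<lambda>i. if Suc i \<le> 1 then 0 else Suc (e (Suc i - 1))) ` {1..k} = (\<lambda>i. Suc (e i)) ` {1..k}"
    by (intro image_cong) auto
  moreover have "(\<lambda>i. Suc (e i)) ` {1..k} = Suc ` A"
    using assms by (auto simp: enumerates_def)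
  ultimately have "(\<lambda>i. if i \<le> 1 then 0 else Suc (e (i - 1))) ` {1..Suc k} = insert 0 (Suc ` A)"
    by (simp only: image_insert image_image) simp
  moreover have "strict_mono_on {1..Suc k} (\<lambda>i. if i \<le> 1 then 0 else Suc (e (i - 1)))"
  proof (rule strict_mono_onI)
    fix r s assume *: "r \<in> {1..Suc k}" "s \<in> {1..Suc k}" "r < s"
    then obtain r' s' where "r = Suc r'" "s = Suc s'"
      by (cases r; cases s) auto
    with * show "(if r \<le> 1 then 0 else Suc (e (r - 1))) < (if s \<le> 1 then 0 else Suc (e (s - 1)))"
      using enumerates_less_iff[OF assms, of r' s'] by auto
  qed
  ultimately show ?thesis by (simp add: enumerates_def)
qed

text \<open>The entries 1 and \<open>length s\<close> lie on different sides of the cut; their order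
  rules out one of the two decompositions.\<close>

lemma not_sum_and_skew_cut:
  assumes "perm s" "sum_cut s g" shows "\<not> skew_cut s g"
proof
  assume sk: "skew_cut s g"
  then have g: "1 \<le> g" "g < length s" by (auto simp: skew_cut_def)
  then have "1 \<in> set s" "length s \<in> set s"
    using assms(1) by (simp_all add: perm_mem_iff del: length_greater_0_conv)
  then have "subseq [1, length s] s \<or> subseq [length s, 1] s"
    using subseq2_total[of 1 s "length s"] g by auto
  with sk assms(2) g show False
    unfolding sum_cut_def skew_cut_def by blast
qed

lemma enumerates_first:
  assumes "enumerates e k (sites s)" "perm s"
  shows "1 \<le> k" "e 1 = 0"
proof -
  have "0 \<in> sites s" using assms(2) by (simp add: sites_def legal_0)
  then obtain i where i: "i \<in> {1..k}" "e i = 0"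
    using assms(1) by (elim enumeratesE)
  then show "1 \<le> k" by simp
  then have "e 1 \<le> e i"
    using enumerates_le_iff[OF assms(1), of 1 i] i by simp
  with i show "e 1 = 0" by simp
qed

lemma enumerates_eq_length_iff:
  assumes "enumerates e k (sites s)" "j \<in> {1..k}"
  shows "e j = length s \<longleftrightarrow> length s \<in> sites s \<and> j = k"
proof
  assume j: "e j = length s"
  have "e i \<in> sites s" if "i \<in> {1..k}" for i
    using assms(1) that by (auto simp: enumerates_def)
  then have "length s \<in> sites s" "e k \<le> e j"
    using j assms(2) by (force simp: sites_def)+
  then show "length s \<in> sites s \<and> j = k"
    using enumerates_le_iff[OF assms(1), of k j] assms(2) by auto
next
  assume *: "length s \<in> sites s \<and> j = k"
  then have "length s \<in> sites s" by simp
  with assms(1) obtain i where i: "i \<in> {1..k}" "e i = length s"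
    by (rule enumeratesE)
  then have "e i \<le> e j"
    using enumerates_le_iff[OF assms(1), of i j] assms(2) * by auto
  moreover have "e j \<in> sites s"
    using assms by (auto simp: enumerates_def)
  ultimately show "e j = length s"
    using i by (auto simp: sites_def)
qed

section \<open>The state after one extension\<close>

lemma has_state_app_0:
  assumes "has_state s (k, S, T, t)"
  shows "has_state (app s 0) (step (k, S, T, t) 1)"
proof -
  from assms obtain e where s: "perm s" "s \<noteq> []"
    and e: "enumerates e k (sites s)" and S: "S = {j\<in>{1..k}. sum_cut s (e j)}"
    and t: "t = (length s \<in> sites s)" and T: "t \<Longrightarrow> T = {j\<in>{1..k}. skew_cut s (e j)}"
    by auto
  define e' where "e' i = (if i \<le> 1 then 0 else Suc (e (i - 1)))" for i :: nat
  have e': "enumerates e' (Suc k) (sites (app s 0))"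
    unfolding sites_app_0[OF s(1)] e'_def using e by (rule enumerates_shift)
  have sum: "sum_cut (app s 0) h \<longleftrightarrow> h = Suc (length s)" for h
    using sum_cut_app[OF s(1), of 0 h] by (auto simp: sum_cut_def)
  have skew: "skew_cut (app s 0) (Suc h) \<longleftrightarrow> skew_cut s h \<or> h = 0" "\<not> skew_cut (app s 0) 0" for h
    using skew_cut_app[OF s(1), of 0] s(2) by auto
  have top: "length (app s 0) \<in> sites (app s 0) \<longleftrightarrow> t"
    unfolding sites_app_0[OF s(1)] t by auto
  \<comment> \<open>The only sum cut is the topmost gap; it has a rank, namely \<open>Suc k\<close>,
    only if it is a site.\<close>
  have "(if t then {Suc k} else {}) = {j\<in>{1..Suc k}. sum_cut (app s 0) (e' j)}"
    unfolding sum using enumerates_eq_length_iff[OF e'] top by auto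
  moreover have "insert 2 (Suc ` T) = {j\<in>{1..Suc k}. skew_cut (app s 0) (e' j)}" if t
  proof (intro set_eqI)
    fix i
    \<comment> \<open>The new skew cut 1 is the old gap 0, whose rank 1 becomes 2.\<close>
    have "e (i - 1) = 0 \<longleftrightarrow> i = 2" if "2 \<le> i" "i \<le> Suc k"
    proof -
      have "e (i - 1) = e 1 \<longleftrightarrow> i - 1 = 1"
        using that by (intro inj_on_eq_iff[OF enumerates_inj[OF e]]) auto
      with that show ?thesis
        using enumerates_first[OF e s(1)] by auto
    qed
    then show "i \<in> insert 2 (Suc ` T) \<longleftrightarrow> i \<in> {j\<in>{1..Suc k}. skew_cut (app s 0) (e' j)}"
      using enumerates_first[OF e s(1)] skew
      by (cases "i \<le> 1"; cases i) (auto simp: T[OF that] e'_def)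
  qed
  moreover have "perm (app s 0)" "app s 0 \<noteq> []"
    using s perm_app[of s 0] by (auto simp: app_def)
  ultimately show ?thesis
    using e' top by auto
qed

lemma has_state_app_pos:
  assumes st: "perm s" "s \<noteq> []" "enumerates e k (sites s)" "S = {j\<in>{1..k}. sum_cut s (e j)}"
    "t = (length s \<in> sites s)" "t \<longrightarrow> T = {j\<in>{1..k}. skew_cut s (e j)}"
    and j: "1 < j" "j \<le> k"
  shows "has_state (app s (e j)) (step (k, S, T, t) j)"
proof -
  define g where "g = e j"
  have jk: "j \<in> {1..k}" using j by simp
  have g: "g \<in> sites s" "0 < g" "g \<le> length s"
  proof -
    show "g \<in> sites s" using st(3) jk by (auto simp: g_def enumerates_def)
    then show "g \<le> length s" by (simp add: sites_def)
    show "0 < g"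
      using enumerates_less_iff[OF st(3), of 1 j] enumerates_first[OF st(3,1)] j by (simp add: g_def)
  qed
  let ?A = "{h \<in> sites s. h \<le> g}"
  have eA: "enumerates e j ?A"
    unfolding g_def using st(3) jk by (rule enumerates_restrict)
  have e_le: "e i \<le> g" if "i \<in> {1..j}" for i
    using eA that by (auto simp: enumerates_def)
  have top: "g = length s \<longleftrightarrow> t \<and> j = k"
    using enumerates_eq_length_iff[OF st(3) jk] st(5) by (simp add: g_def)
  have sites: "sites (app s g) = ?A \<union> (if sum_cut s g then {Suc g} else {}) \<union>
           (if skew_cut s g \<and> t then {Suc (length s)} else {})"
    using sites_app_pos[OF st(1) g(2,1)] st(5) by simp
  have jS: "j \<in> S \<longleftrightarrow> sum_cut s g"
    using st(4) jk by (simp add: g_def)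
  have jT: "t \<Longrightarrow> j \<in> T \<longleftrightarrow> skew_cut s g"
    using st(6) jk by (simp add: g_def)
  have p: "perm (app s g)" "app s g \<noteq> []"
    using perm_app[OF st(1) g(3)] by (auto simp: app_def)
  have sum: "sum_cut (app s g) h \<longleftrightarrow> h \<le> g \<and> sum_cut s h \<or> h = Suc (length s)" for h
    using sum_cut_app[OF st(1) g(3)] .
  have sum_low: "{i\<in>{1..j}. sum_cut (app s g) (e i)} = S \<inter> {..j}"
    using e_le g(3) j unfolding sum st(4) by force
  have skew_low: "\<not> skew_cut (app s g) (e i)" if "i \<in> {1..j}" for i
    using e_le[OF that] g(2) unfolding skew_cut_app[OF st(1) g(3)] by auto
  have skew_top: "\<not> skew_cut (app s g) (Suc (length s))"
    by (simp add: skew_cut_def)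
  \<comment> \<open>Separates the surviving ranks from the rank \<open>Suc j\<close> of an added
    site \<open>x\<close>.\<close>
  have upd: "{i\<in>{1..Suc j}. P ((e(Suc j := x)) i)} = {i\<in>{1..j}. P (e i)} \<union> (if P x then {Suc j} else {})"
    for P x
    by (auto simp: le_Suc_eq)
  show ?thesis
  proof (cases "j \<in> S")
    case True
    then have sites': "sites (app s g) = insert (Suc g) ?A"
      using sites jS not_sum_and_skew_cut[OF st(1)] by auto
    have "enumerates (e(Suc j := Suc g)) (Suc j) (sites (app s g))"
      unfolding sites' by (rule enumerates_extend[OF eA]) auto
    moreover have "S \<inter> {..j} \<union> (if t \<and> j = k then {Suc j} else {}) =
        {i\<in>{1..Suc j}. sum_cut (app s g) ((e(Suc j := Suc g)) i)}"
      unfolding upd sum_low using top by (simp add: sum)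
    \<comment> \<open>The added site \<open>Suc g\<close> is the topmost gap exactly if
      \<open>g\<close> was.\<close>
    moreover have "(t \<and> j = k) = (length (app s g) \<in> sites (app s g))"
      unfolding sites' top[symmetric] using g(3) by auto
    moreover have "{} = {i\<in>{1..Suc j}. skew_cut (app s g) ((e(Suc j := Suc g)) i)}" if "t \<and> j = k"
      unfolding upd using skew_low skew_top top that by auto
    ultimately show ?thesis
      using True j p unfolding g_def[symmetric] by auto
  next
    case nS: False
    show ?thesis
    proof (cases "t \<and> j \<in> T")
      case True
      then have sites': "sites (app s g) = insert (Suc (length s)) ?A"
        using sites jS jT nS by auto
      have "enumerates (e(Suc j := Suc (length s))) (Suc j) (sites (app s g))"
        unfolding sites' by (rule enumerates_extend[OF eA]) (use g(3) in auto)
      moreover have "insert (Suc j) (S \<inter> {..j}) =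
          {i\<in>{1..Suc j}. sum_cut (app s g) ((e(Suc j := Suc (length s))) i)}"
        unfolding upd sum_low by (simp add: sum)
      moreover have "True = (length (app s g) \<in> sites (app s g))"
        unfolding sites' by auto
      moreover have "{} = {i\<in>{1..Suc j}. skew_cut (app s g) ((e(Suc j := Suc (length s))) i)}"
        unfolding upd using skew_low skew_top by auto
      ultimately show ?thesis
        using True nS j p unfolding g_def[symmetric] by auto
    next
      case False
      then have sites': "sites (app s g) = ?A"
        using sites jS jT nS by auto
      have "enumerates e j (sites (app s g))"
        unfolding sites' by (rule eA)
      moreover have "False = (length (app s g) \<in> sites (app s g))"
        unfolding sites' using g(3) by auto
      ultimately show ?thesis
        using False nS j p sum_low unfolding g_def[symmetric] by auto
    qed
  qed
qed

text \<open>The child at the site of rank \<open>j\<close> has state \<open>step st j\<close>, so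
  the state alone determines the subtree.\<close>

lemma desc_eq_count_desc: "has_state s st \<Longrightarrow> desc d s = count_desc d st"
proof (induction d arbitrary: s st)
  case (Suc d)
  obtain k S T t where st: "st = (k, S, T, t)" by (cases st)
  with Suc.prems obtain e where e: "perm s" "s \<noteq> []" "enumerates e k (sites s)"
    "S = {j\<in>{1..k}. sum_cut s (e j)}" "t = (length s \<in> sites s)"
    "t \<longrightarrow> T = {j\<in>{1..k}. skew_cut s (e j)}"
    by auto
  have "has_state (app s (e j)) (step st j)" if "j \<in> {1..k}" for j
  proof (cases "j = 1")
    case True
    with enumerates_first[OF e(3,1)] has_state_app_0[of s k S T t] Suc.prems st
    show ?thesis by simp
  next
    case False
    with that show ?thesis
      unfolding st by (intro has_state_app_pos[OF e]) auto
  qed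
  then have "(\<Sum>j=1..k. desc d (app s (e j))) = (\<Sum>j=1..k. count_desc d (step st j))"
    by (intro sum.cong Suc.IH) auto
  moreover have "(\<Sum>g\<in>sites s. desc d (app s g)) = (\<Sum>j=1..k. desc d (app s (e j)))"
  proof -
    have "sites s = e ` {1..k}"
      using e(3) by (simp add: enumerates_def)
    then show ?thesis
      using sum.reindex[OF enumerates_inj[OF e(3)], of "\<lambda>g. desc d (app s g)"] by (simp add: comp_def)
  qed
  ultimately show ?case
    by (simp add: st)
qed auto

text \<open>The root of the counted tree; its state is the case \<open>k = a = 2\<close> of the
  family of \<open>gfP\<close>.\<close>

lemma has_state_1: "has_state [1] (2, {2}, {}, True)"
proof -
  have p: "perm []" by (simp add: perm_def)
  have one: "[1] = app [] 0" by (simp add: app_def)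
  have "sites [] = {0}"
    using legal_0[OF p] by (auto simp: sites_def)
  then have sites: "sites [1] = {0, 1}"
    unfolding one sites_app_0[OF p] by simp
  have "sum_cut [1] h \<longleftrightarrow> h = 1" "\<not> skew_cut [1] h" for h
    unfolding one sum_cut_app[OF p, of 0, simplified] skew_cut_app[OF p, of 0, simplified]
    by (auto simp: sum_cut_def skew_cut_def)
  moreover have "enumerates (\<lambda>i. i - 1) 2 {0, 1}"
    by (auto simp: enumerates_def strict_mono_on_def numeral_2_eq_2 atLeastAtMostSuc_conv)
  moreover have "perm [1]" by (auto simp: perm_def)
  ultimately show ?thesis
    using sites by (auto intro!: exI[of _ "\<lambda>i. i - 1"])
qed

lemma avoiders_0: "avoiders 0 = {[]}"
proof -
  have "avoids []"
    by (simp add: avoids_def contains_4123_iff[unfolded One_nat_def] contains_1324_iff[unfolded One_nat_def]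
        contains_31524_iff[unfolded One_nat_def])
  then show ?thesis
    by (auto simp: avoiders_def perm_def)
qed

lemma card_avoiders_Suc: "card (avoiders (Suc d)) = count_desc d (2, {2}, {}, True)"
proof -
  have "sites [] = {0}"
    using legal_0[of "[]"] by (auto simp: sites_def perm_def)
  then have "(SIGMA s:avoiders 0. sites s) = {([], 0)}"
    by (auto simp: avoiders_0)
  then have "avoiders 1 = {[1]}"
    using avoiders_Suc[of 0] by (simp add: app_def)
  then show ?thesis
    using sum_desc_avoiders[of d 1] desc_eq_count_desc[OF has_state_1, of d] by simp
qed

section \<open>Generating functions of the states\<close>

abbreviation X :: "real fps" where "X \<equiv> fps_X"

section \<open>The Catalan series\<close>

definition sqr :: "real fps" where
  "sqr = fps_sqrt (1 - 4 * X)"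

text \<open>The series (1 - sqrt(1 - 4z)) / (2z); the shift divides by \<open>X\<close>, the
  constant coefficient being 0.\<close>

definition cat :: "real fps" where
  "cat = fps_shift 1 (fps_const (1 / 2) * (1 - sqr))"

lemma sqr_sq: "sqr ^ 2 = 1 - 4 * X"
  using power_radical[of "1 - 4 * X" root 1] by (simp add: sqr_def fps_sqrt_def numeral_2_eq_2)

lemma sqr_nth_0: "fps_nth sqr 0 = 1"
  by (simp add: sqr_def fps_sqrt_def)

lemma sqr_eq: "sqr = 1 - 2 * (X * cat)"
proof -
  have "X * cat = fps_const (1 / 2) * (1 - sqr)"
  proof (rule fps_ext)
    show "fps_nth (X * cat) n = fps_nth (fps_const (1 / 2) * (1 - sqr)) n" for n
      by (cases n) (simp_all add: cat_def sqr_nth_0)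
  qed
  then have "2 * (X * cat) = (2 * fps_const (1 / 2)) * (1 - sqr)"
    by (simp only: mult.assoc)
  also have "2 * fps_const (1 / 2 :: real) = 1"
    by (simp add: numeral_fps_const)
  finally show ?thesis by simp
qed

lemma cat_eq: "cat = 1 + X * cat ^ 2"
proof -
  have "(1 - 2 * (X * cat)) ^ 2 = 1 - 4 * X"
    using sqr_sq by (simp add: sqr_eq)
  then have "4 * X * (1 + X * cat ^ 2 - cat) = 0"
    by algebra
  then show ?thesis by simp
qed

lemma cat_nth_0: "fps_nth cat 0 = 1"
  by (subst cat_eq) simp

lemma cat_inv: "cat * (1 - X * cat) = 1"
  using cat_eq by algebra

definition ivd :: "real fps" where "ivd = inverse (1 - 3 * X + X ^ 2)"
definition iv1 :: "real fps" where "iv1 = inverse (1 - X)"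
definition iv2 :: "real fps" where "iv2 = inverse (1 - 2 * X)"
text \<open>Since \<open>2 - cat = sqr * cat\<close>, this inverse brings the square root into the
  denominator.\<close>

definition ivr :: "real fps" where "ivr = inverse (2 - cat)"

lemma ivd: "ivd * (1 - 3 * X + X ^ 2) = 1"
  unfolding ivd_def by (rule inverse_mult_eq_1) simp
lemma iv1: "iv1 * (1 - X) = 1"
  unfolding iv1_def by (rule inverse_mult_eq_1) simp
lemma iv2: "iv2 * (1 - 2 * X) = 1"
  unfolding iv2_def by (rule inverse_mult_eq_1) simp
lemma ivr: "ivr * (2 - cat) = 1"
  unfolding ivr_def by (rule inverse_mult_eq_1) (simp add: cat_nth_0)

text \<open>The series \<open>gfM\<close>, \<open>gfP\<close>, \<open>gfQ\<close> below belong to the states \<open>(k, {a..<k}, {}, False)\<close>,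
  \<open>(k, {a..k}, {}, True)\<close> and \<open>(k, {k}, {2..m}, True)\<close>; the states \<open>(k, {}, {}, False)\<close> have the
  series \<open>cat ^ k\<close>.  The auxiliary series come from solving the recurrences: \<open>tau i\<close> is
  the sum of \<open>X ^ j * mu (i + j)\<close> over all \<open>j\<close>, and \<open>gfP k k = alp + gam * cat ^ k\<close>.\<close>

fun mu :: "nat \<Rightarrow> real fps" where
  "mu 0 = iv1 * (1 + X * cat ^ 3)"
| "mu (Suc i) = iv2 * ((1 - X) * mu i + X * cat ^ (i + 3) * (cat - 1))"

definition tau :: "nat \<Rightarrow> real fps" where
  "tau i = ivd * ((1 - 2 * X) * mu i + X ^ 2 * cat ^ 4 * (cat - 1) * cat ^ i)"

definition gam :: "real fps" where
  "gam = ivr * ((1 - X * cat) ^ 2 * (1 - X) * tau 0 - X * cat ^ 2)"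

definition alp :: "real fps" where
  "alp = ivd * ((1 - X) * (1 - gam * cat) + (1 - X) ^ 2 * (gam * cat ^ 2 - cat))"

definition eps1 :: "real fps" where "eps1 = iv1 * X * alp"
definition eps0 :: "real fps" where "eps0 = iv1 * (X * eps1 - gam * cat + 1)"

definition gfM :: "nat \<Rightarrow> nat \<Rightarrow> real fps" where
  "gfM k a = cat ^ (a - 2) * mu (k - a)"

definition gfP :: "nat \<Rightarrow> nat \<Rightarrow> real fps" where
  "gfP k a = cat ^ (a - 2) * (1 - X) * tau (k - a) + alp + X * (gam - 1) * cat ^ (k + 2)"

definition gfQ :: "nat \<Rightarrow> nat \<Rightarrow> real fps" where
  "gfQ k m = eps0 + of_nat m * eps1 + (gam * cat - 1) * cat ^ m + gam * cat ^ k"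

section \<open>Linear relations between the auxiliary series\<close>

lemma mu_0: "(1 - X) * mu 0 = 1 + X * cat ^ 3"
proof -
  have "(1 - X) * mu 0 = (iv1 * (1 - X)) * (1 + X * cat ^ 3)"
    by (simp only: mu.simps mult_ac)
  then show ?thesis by (simp only: iv1 mult_1_left)
qed

lemma mu_Suc: "(1 - 2 * X) * mu (Suc i) = (1 - X) * mu i + X * cat ^ (i + 3) * (cat - 1)"
proof -
  have "(1 - 2 * X) * mu (Suc i) = (iv2 * (1 - 2 * X)) * ((1 - X) * mu i + X * cat ^ (i + 3) * (cat - 1))"
    by (simp only: mu.simps mult_ac)
  then show ?thesis by (simp only: iv2 mult_1_left)
qed

text \<open>Splits off the first term of the sum that \<open>tau\<close> stands for; with the
  denominator cleared it follows from \<open>mu_Suc\<close>.\<close>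

lemma tau_eq: "tau i = mu i + X * tau (Suc i)"
proof -
  define x where "x = cat ^ i"
  have "(1 - 3 * X + X ^ 2) * (tau i - mu i - X * tau (Suc i)) = 0"
    using ivd mu_Suc[of i] cat_eq
    unfolding tau_def power_Suc power_add x_def[symmetric] by algebra
  moreover have "1 - 3 * X + X ^ 2 \<noteq> 0"
    using ivd by auto
  ultimately have "tau i - mu i - X * tau (Suc i) = 0"
    using mult_eq_0_iff by blast
  then show ?thesis by algebra
qed

text \<open>Solved for \<open>gam\<close>, this is the definition of \<open>gam\<close>, chosen so
  that \<open>gfP k k\<close> takes the form \<open>alp + gam * cat ^ k\<close>.\<close>

lemma tau_0: "(1 - X) * tau 0 = cat ^ 2 * (gam - X * (gam - 1) * cat ^ 2)"
proof -
  have "(2 - cat) * gam = (1 - X * cat) ^ 2 * (1 - X) * tau 0 - X * cat ^ 2"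
    using ivr unfolding gam_def by algebra
  then show ?thesis
    using cat_inv cat_eq by algebra
qed

lemma eps1: "(1 - X) * eps1 = X * alp"
  using iv1 unfolding eps1_def by algebra

lemma eps0: "(1 - X) * eps0 = X * eps1 - gam * cat + 1"
  using iv1 unfolding eps0_def by algebra

lemma alp: "(1 - 3 * X + X ^ 2) * alp = (1 - X) * (1 - gam * cat) + (1 - X) ^ 2 * (gam * cat ^ 2 - cat)"
  using ivd unfolding alp_def by algebra

text \<open>Expresses that \<open>gfQ k 1\<close> and \<open>gfP k k\<close> agree, as they must:
  \<open>{2..1}\<close> is empty, so both belong to one state.\<close>

lemma alp_eq: "alp = eps0 + eps1 + (gam * cat - 1) * cat"
proof -
  have "(1 - X) ^ 2 * (alp - (eps0 + eps1 + (gam * cat - 1) * cat)) = 0"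
    using alp eps0 eps1 by algebra
  moreover have "(1 - X) ^ 2 \<noteq> 0"
    using iv1 by auto
  ultimately show ?thesis by simp
qed

lemma alp_eq': "(1 - X) * alp = X * (eps0 + 2 * eps1 + (gam * cat - 1) * cat ^ 2)"
  using alp_eq eps0 eps1 cat_eq by algebra

section \<open>Functional equations of the four families\<close>

lemma low_sum: "2 \<le> a \<Longrightarrow> 1 + X * (\<Sum>j\<in>{2..<a}. cat ^ j) = cat ^ (a - 2)"
proof (induction a rule: dec_induct)
  case (step a)
  have pow: "cat ^ a = cat ^ (a - 2) * cat ^ 2"
    using step.hyps(1) by (metis le_add_diff_inverse2 power_add)
  have "1 + X * (\<Sum>j\<in>{2..<Suc a}. cat ^ j) = cat ^ (a - 2) + X * cat ^ a"
    using step by (simp add: distrib_left)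
  \<comment> \<open>The sum telescopes because \<open>1 + X * cat ^ 2\<close> is
    \<open>cat\<close>.\<close>
  also have "\<dots> = cat ^ (a - 2) * (1 + X * cat ^ 2)"
    unfolding pow by (simp add: algebra_simps)
  also have "\<dots> = cat ^ (Suc a - 2)"
  proof -
    have "Suc a - 2 = Suc (a - 2)" using step.hyps(1) by simp
    then show ?thesis by (simp add: cat_eq[symmetric] mult.commute)
  qed
  finally show ?case .
qed simp

text \<open>The Catalan tree: without cuts, a node with \<open>k\<close> sites has children with 2,
  ..., \<open>k + 1\<close> sites.\<close>

lemma gfN_eq:
  assumes "1 \<le> k"
  shows "cat ^ k = 1 + X * (cat ^ Suc k + (\<Sum>j\<in>{2..<Suc k}. cat ^ j))"
proof -
  obtain b where k: "k = Suc b" using assms by (cases k) auto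
  have "1 + X * (cat ^ Suc k + (\<Sum>j\<in>{2..<Suc k}. cat ^ j)) = cat ^ b * (1 + X * cat ^ 2)"
    using low_sum[of "Suc k"] assms by (simp add: k algebra_simps power2_eq_square)
  then show ?thesis
    using cat_eq by (simp add: k)
qed

text \<open>Induction on \<open>k - a\<close>, with \<open>mu_0\<close> as start and
  \<open>mu_Suc\<close> as increment.\<close>

lemma gfM_sum:
  assumes "2 \<le> a" "a \<le> k"
  shows "X * (\<Sum>j\<in>{a..<k}. gfM (Suc j) a) = (1 - X) * gfM k a - cat ^ (a - 2) - X * cat ^ Suc k"
proof -
  obtain b where a: "a = b + 2"
    using assms(1) le_Suc_ex by (metis add.commute)
  define x where "x = cat ^ b"
  have M: "gfM (a + i) a = x * mu i" for i
    by (simp add: gfM_def a x_def)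
  have "X * (\<Sum>j\<in>{a..<a+i}. gfM (Suc j) a) = (1 - X) * (x * mu i) - x - X * (x * cat ^ (i + 3))" for i
  proof (induction i)
    case 0
    have "0 = (1 - X) * (x * mu 0) - x - X * (x * cat ^ 3)"
      using mu_0 by algebra
    then show ?case by (simp del: mu.simps)
  next
    case (Suc i)
    have "X * (\<Sum>j\<in>{a..<a+Suc i}. gfM (Suc j) a) =
        (1 - X) * (x * mu i) - x - X * (x * cat ^ (i + 3)) + X * (x * mu (Suc i))"
      using Suc.IH M[of "Suc i"] by (simp add: distrib_left del: mu.simps)
    also have "\<dots> = (1 - X) * (x * mu (Suc i)) - x - X * (x * (cat * cat ^ (i + 3)))"
    proof -
      define y where "y = cat ^ (i + 3)"
      show ?thesis
        using mu_Suc[of i] unfolding y_def[symmetric] by algebra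
    qed
    finally show ?case by (simp only: add_Suc power_Suc)
  qed
  from this[of "k - a"] have "X * (\<Sum>j\<in>{a..<k}. gfM (Suc j) a) =
      (1 - X) * gfM k a - x - X * (x * cat ^ (k - a + 3))"
    using M[of "k - a"] assms(2) by (simp only: le_add_diff_inverse)
  moreover have "b + (k - a + 3) = Suc k" "a - 2 = b"
    using assms a by auto
  ultimately show ?thesis
    by (simp only: x_def power_add[symmetric])
qed

text \<open>Summands by rank of the chosen site: 1, those below \<open>a\<close>, the sum cuts, and
  \<open>k\<close>, which reproduces the same state.\<close>

lemma gfM_eq:
  assumes "2 \<le> a" "a < k"
  shows "gfM k a = 1 + X * (cat ^ Suc k + (\<Sum>j\<in>{2..<a}. cat ^ j) + (\<Sum>j\<in>{a..<k}. gfM (Suc j) a) + gfM k a)"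
proof -
  have "1 + X * (cat ^ Suc k + (\<Sum>j\<in>{2..<a}. cat ^ j) + (\<Sum>j\<in>{a..<k}. gfM (Suc j) a) + gfM k a)
    = (1 + X * (\<Sum>j\<in>{2..<a}. cat ^ j)) + X * cat ^ Suc k + X * (\<Sum>j\<in>{a..<k}. gfM (Suc j) a) + X * gfM k a"
    by (simp only: distrib_left add_ac)
  then show ?thesis
    using assms by (simp add: low_sum gfM_sum algebra_simps)
qed

lemma gfQ_2: "X * gfQ (Suc k) 2 = alp - X * alp + X * gam * cat ^ Suc k"
  using alp_eq' by (simp add: gfQ_def algebra_simps)

text \<open>Rank 1 leads to the family of \<open>gfQ\<close>, rank \<open>k\<close> to the same
  family with \<open>k\<close> increased; \<open>tau_eq\<close> resolves this infinite
  recursion.\<close>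

lemma gfP_eq:
  assumes "2 \<le> a" "a \<le> k"
  shows "gfP k a = 1 + X * (gfQ (Suc k) 2 + (\<Sum>j\<in>{2..<a}. cat ^ j) + (\<Sum>j\<in>{a..<k}. gfM (Suc j) a) +
    gfP (Suc k) a)"
proof -
  have "1 + X * (gfQ (Suc k) 2 + (\<Sum>j\<in>{2..<a}. cat ^ j) + (\<Sum>j\<in>{a..<k}. gfM (Suc j) a) + gfP (Suc k) a)
     = (1 + X * (\<Sum>j\<in>{2..<a}. cat ^ j)) + X * gfQ (Suc k) 2 + X * (\<Sum>j\<in>{a..<k}. gfM (Suc j) a)
       + X * gfP (Suc k) a"
    by (simp add: algebra_simps)
  also have "\<dots> = alp - X * alp + X * gam * cat ^ Suc k + (1 - X) * gfM k a - X * cat ^ Suc k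
       + X * gfP (Suc k) a"
    using low_sum[of a] gfM_sum[of a k] gfQ_2[of k] assms by simp
  also have "\<dots> = gfP k a"
  proof -
    define x where "x = cat ^ (a - 2)"
    define y where "y = cat ^ k"
    have eq: "Suc k - a = Suc (k - a)" using assms by simp
    show ?thesis
      using tau_eq[of "k - a"] cat_eq
      unfolding eq gfP_def gfM_def power_add power_Suc x_def[symmetric] y_def[symmetric] by algebra
  qed
  finally show ?thesis ..
qed

lemma gfP_diag:
  assumes "2 \<le> k" shows "gfP k k = alp + gam * cat ^ k"
proof -
  obtain b where k: "k = b + 2"
    using assms le_Suc_ex by (metis add.commute)
  define x where "x = cat ^ b"
  have eq: "k - 2 = b" "k - k = 0" using k by auto
  show ?thesis
    using tau_0 unfolding gfP_def eq unfolding k power_add x_def[symmetric] by algebra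
qed

lemma gfP_subdiag:
  assumes "2 \<le> k"
  shows "X * gfP (Suc k) k = cat ^ (k - 2) * (cat ^ 2 * (gam - X * (gam - 1) * cat ^ 2) - 1 - X * cat ^ 3)
    + X * alp + X ^ 2 * (gam - 1) * cat ^ (k + 3)"
proof -
  define x where "x = cat ^ (k - 2)"
  define y where "y = cat ^ k"
  have eq: "Suc k - k = Suc 0" by simp
  show ?thesis
    using tau_eq[of 0] tau_0 mu_0
    unfolding gfP_def eq power_add power_Suc x_def[symmetric] y_def[symmetric] by algebra
qed

lemma gfP_diag_sum:
  assumes "1 \<le> m"
  shows "X * (\<Sum>j\<in>{2..<Suc m}. gfP (Suc j) (Suc j)) = X * (of_nat m - 1) * alp + gam * (cat ^ m - cat)"
proof -
  have "(\<Sum>j\<in>{2..<Suc m}. gfP (Suc j) (Suc j)) = (\<Sum>j\<in>{2..<Suc m}. alp + gam * cat * cat ^ j)"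
    by (intro sum.cong) (auto simp: gfP_diag)
  also have "\<dots> = (of_nat m - 1) * alp + gam * cat * (\<Sum>j\<in>{2..<Suc m}. cat ^ j)"
    using assms by (simp add: sum.distrib sum_distrib_left of_nat_diff del: sum.op_ivl_Suc)
  finally have "X * (\<Sum>j\<in>{2..<Suc m}. gfP (Suc j) (Suc j)) =
      X * (of_nat m - 1) * alp + gam * cat * (1 + X * (\<Sum>j\<in>{2..<Suc m}. cat ^ j) - 1)"
    by (simp only: distrib_left add_diff_cancel_left' mult_ac)
  also have "1 + X * (\<Sum>j\<in>{2..<Suc m}. cat ^ j) = cat ^ (m - 1)"
    using low_sum[of "Suc m"] assms by (simp del: sum.op_ivl_Suc)
  also have "gam * cat * (cat ^ (m - 1) - 1) = gam * (cat ^ m - cat)"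
    using assms by (cases m) (simp_all add: algebra_simps)
  finally show ?thesis .
qed

lemma mid_sum:
  assumes "1 \<le> m" "m < k"
  shows "X * (\<Sum>j\<in>{Suc m..<k}. cat ^ j) = cat ^ (k - 2) - cat ^ (m - 1)"
proof -
  have "(\<Sum>j\<in>{2..<Suc m}. cat ^ j) + (\<Sum>j\<in>{Suc m..<k}. cat ^ j) = (\<Sum>j\<in>{2..<k}. cat ^ j)"
    using assms by (intro sum.atLeastLessThan_concat) auto
  then have "X * (\<Sum>j\<in>{Suc m..<k}. cat ^ j) =
      (1 + X * (\<Sum>j\<in>{2..<k}. cat ^ j)) - (1 + X * (\<Sum>j\<in>{2..<Suc m}. cat ^ j))"
    by (metis add_diff_cancel_left distrib_left add_diff_cancel_left')
  then show ?thesis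
    using low_sum[of k] low_sum[of "Suc m"] assms by (simp del: sum.op_ivl_Suc)
qed

text \<open>Each of the \<open>m - 1\<close> skew cuts leads to a state
  \<open>(Suc j, {Suc j}, {}, True)\<close> and contributes one \<open>alp\<close>; hence the term
  of \<open>gfQ\<close> linear in \<open>m\<close>.\<close>

lemma gfQ_eq:
  assumes "1 \<le> m" "m < k"
  shows "gfQ k m = 1 + X * (gfQ (Suc k) (Suc m) + (\<Sum>j\<in>{2..<Suc m}. gfP (Suc j) (Suc j)) +
    (\<Sum>j\<in>{Suc m..<k}. cat ^ j) + gfP (Suc k) k)"
proof -
  obtain b where k: "k = b + 2"
    using assms le_Suc_ex[of 2 k] by auto
  obtain l where m: "m = Suc l"
    using assms by (cases m) auto
  have "1 + X * (gfQ (Suc k) (Suc m) + (\<Sum>j\<in>{2..<Suc m}. gfP (Suc j) (Suc j)) +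
    (\<Sum>j\<in>{Suc m..<k}. cat ^ j) + gfP (Suc k) k) =
    1 + X * gfQ (Suc k) (Suc m) + X * (\<Sum>j\<in>{2..<Suc m}. gfP (Suc j) (Suc j)) +
    X * (\<Sum>j\<in>{Suc m..<k}. cat ^ j) + X * gfP (Suc k) k"
    by (simp add: algebra_simps)
  also have "\<dots> = 1 + X * gfQ (Suc k) (Suc m) + (X * (of_nat m - 1) * alp + gam * (cat ^ m - cat)) +
    (cat ^ (k - 2) - cat ^ (m - 1)) + (cat ^ (k - 2) * (cat ^ 2 * (gam - X * (gam - 1) * cat ^ 2) - 1 - X * cat ^ 3)
    + X * alp + X ^ 2 * (gam - 1) * cat ^ (k + 3))"
    using assms by (simp only: gfP_diag_sum mid_sum gfP_subdiag)
  also have "\<dots> = gfQ k m"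
  proof -
    define x where "x = cat ^ b"
    define y where "y = cat ^ l"
    define n where "n = (of_nat l :: real fps)"
    show ?thesis
      using eps0 eps1 cat_eq unfolding gfQ_def k m
      by (simp add: power_add x_def[symmetric] y_def[symmetric] n_def[symmetric]) algebra
  qed
  finally show ?thesis ..
qed

section \<open>The generating function of the class\<close>

lemma sum_split_sites:
  fixes f :: "nat \<Rightarrow> 'a :: comm_monoid_add"
  assumes "2 \<le> a" "a \<le> k"
  shows "(\<Sum>j=1..k. f j) = f 1 + (\<Sum>j\<in>{2..<a}. f j) + (\<Sum>j\<in>{a..<k}. f j) + f k"
proof -
  have "{1..k} = insert 1 (insert k ({2..<a} \<union> {a..<k}))"
    using assms by auto
  moreover have "(\<Sum>j\<in>{2..<a} \<union> {a..<k}. f j) = (\<Sum>j\<in>{2..<a}. f j) + (\<Sum>j\<in>{a..<k}. f j)"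
    by (rule sum.union_disjoint) auto
  ultimately show ?thesis
    using assms by (simp add: add_ac del: sum.op_ivl_Suc)
qed

lemma fps_nth_one_plus_X:
  assumes "F = 1 + X * E"
  shows "fps_nth F 0 = 1" "fps_nth F (Suc d) = fps_nth E d"
  by (simp_all add: assms)

text \<open>All four claims are proved together, because \<open>step\<close> leads from one family
  to another; coefficient \<open>d + 1\<close> of a series is coefficient \<open>d\<close> of the
  sum over the children.\<close>

lemma count_desc_gf:
  "1 \<le> k \<Longrightarrow> real (count_desc d (k, {}, {}, False)) = fps_nth (cat ^ k) d"
  "2 \<le> a \<Longrightarrow> a < k \<Longrightarrow> real (count_desc d (k, {a..<k}, {}, False)) = fps_nth (gfM k a) d"
  "2 \<le> a \<Longrightarrow> a \<le> k \<Longrightarrow> real (count_desc d (k, {a..k}, {}, True)) = fps_nth (gfP k a) d"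
  "1 \<le> m \<Longrightarrow> m < k \<Longrightarrow> real (count_desc d (k, {k}, {2..m}, True)) = fps_nth (gfQ k m) d"
proof (induction d arbitrary: k a m)
  case 0
  {
    case 1
    then show ?case using fps_nth_one_plus_X(1)[OF gfN_eq] by simp
  next
    case 2
    then show ?case using fps_nth_one_plus_X(1)[OF gfM_eq] by simp
  next
    case 3
    then show ?case using fps_nth_one_plus_X(1)[OF gfP_eq] by simp
  next
    case 4
    then show ?case using fps_nth_one_plus_X(1)[OF gfQ_eq] by simp
  }
next
  case (Suc d)
  {
    case 1
    let ?st = "(k, {}, {}, False) :: state"
    have "real (count_desc (Suc d) ?st) = (\<Sum>j=1..k. real (count_desc d (step ?st j)))"
      by simp
    also have "{1..k} = insert 1 {2..<Suc k}"
      using 1 by auto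
    also have "(\<Sum>j\<in>insert 1 {2..<Suc k}. real (count_desc d (step ?st j))) =
        real (count_desc d (Suc k, {}, {}, False)) + (\<Sum>j\<in>{2..<Suc k}. real (count_desc d (j, {}, {}, False)))"
      by (simp del: sum.op_ivl_Suc)
    also have "\<dots> = fps_nth (cat ^ Suc k + (\<Sum>j\<in>{2..<Suc k}. cat ^ j)) d"
      by (simp add: Suc.IH(1) fps_sum_nth del: sum.op_ivl_Suc power_Suc)
    finally show ?case
      using fps_nth_one_plus_X(2)[OF gfN_eq[OF 1]] by simp
  next
    case 2
    let ?st = "(k, {a..<k}, {}, False) :: state"
    let ?E = "cat ^ Suc k + (\<Sum>j\<in>{2..<a}. cat ^ j) + (\<Sum>j\<in>{a..<k}. gfM (Suc j) a) + gfM k a"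
    have "step ?st 1 = (Suc k, {}, {}, False)" "step ?st k = (k, {a..<k}, {}, False)"
      using 2 by auto
    moreover have "step ?st j = (j, {}, {}, False)" if "j \<in> {2..<a}" for j
      using that by auto
    moreover have "step ?st j = (Suc j, {a..<Suc j}, {}, False)" if "j \<in> {a..<k}" for j
      using that 2 by auto
    ultimately have "(\<Sum>j=1..k. real (count_desc d (step ?st j))) = fps_nth ?E d"
      unfolding sum_split_sites[OF 2(1) less_imp_le[OF 2(2)]] using 2
      by (simp add: Suc.IH fps_sum_nth del: sum.op_ivl_Suc power_Suc step.simps)
    then show ?case
      using fps_nth_one_plus_X(2)[OF gfM_eq[OF 2]] by simp
  next
    case 3
    let ?st = "(k, {a..k}, {}, True) :: state"
    let ?E = "gfQ (Suc k) 2 + (\<Sum>j\<in>{2..<a}. cat ^ j) + (\<Sum>j\<in>{a..<k}. gfM (Suc j) a) + gfP (Suc k) a"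
    have "step ?st 1 = (Suc k, {Suc k}, {2..2}, True)" "step ?st k = (Suc k, {a..Suc k}, {}, True)"
      using 3 by auto
    moreover have "step ?st j = (j, {}, {}, False)" if "j \<in> {2..<a}" for j
      using that by auto
    moreover have "step ?st j = (Suc j, {a..<Suc j}, {}, False)" if "j \<in> {a..<k}" for j
      using that 3 by auto
    ultimately have "(\<Sum>j=1..k. real (count_desc d (step ?st j))) = fps_nth ?E d"
      unfolding sum_split_sites[OF 3] using 3 Suc.IH(4)[of 2 "Suc k"]
      by (simp add: Suc.IH(1-3) fps_sum_nth del: sum.op_ivl_Suc power_Suc step.simps)
    then show ?case
      using fps_nth_one_plus_X(2)[OF gfP_eq[OF 3]] by simp
  next
    case (4 k m)
    let ?st = "(k, {k}, {2..m}, True) :: state"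
    let ?E = "gfQ (Suc k) (Suc m) + (\<Sum>j\<in>{2..<Suc m}. gfP (Suc j) (Suc j)) +
      (\<Sum>j\<in>{Suc m..<k}. cat ^ j) + gfP (Suc k) k"
    \<comment> \<open>The ranks are split at \<open>Suc m\<close>, the first one past the skew
      cuts.\<close>
    have le: "2 \<le> Suc m" "Suc m \<le> k"
      using 4 by auto
    have "insert 2 (Suc ` {2..m}) = {2..Suc m}"
      using 4 by (auto simp: image_iff)
    then have "step ?st 1 = (Suc k, {Suc k}, {2..Suc m}, True)" "step ?st k = (Suc k, {k..Suc k}, {}, True)"
      using 4 by auto
    moreover have "step ?st j = (Suc j, {Suc j..Suc j}, {}, True)" if "j \<in> {2..<Suc m}" for j
      using that 4 by auto
    moreover have "step ?st j = (j, {}, {}, False)" if "j \<in> {Suc m..<k}" for j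
      using that 4 by auto
    ultimately have "(\<Sum>j=1..k. real (count_desc d (step ?st j))) = fps_nth ?E d"
      unfolding sum_split_sites[OF le] using 4
      by (simp add: Suc.IH fps_sum_nth
          del: sum.op_ivl_Suc power_Suc step.simps atLeastAtMost_singleton)
    then show ?case
      using fps_nth_one_plus_X(2)[OF gfQ_eq[OF 4]] by simp
  }
qed

text \<open>The 1 counts the empty permutation, and \<open>X\<close> shifts by the length of the
  root \<open>[1]\<close>, whose series is \<open>gfP 2 2\<close>.\<close>

lemma class_gf_eq: "class_gf (Av basis) = 1 + X * (alp + gam * cat ^ 2)"
proof (rule fps_ext)
  fix n
  show "fps_nth (class_gf (Av basis)) n = fps_nth (1 + X * (alp + gam * cat ^ 2)) n"
  proof (cases n)
    case 0
    then show ?thesis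
      unfolding class_gf_def avoiders_eq by (simp add: avoiders_0)
  next
    case (Suc d)
    have "real (count_desc d (2, {2..2}, {}, True)) = fps_nth (gfP 2 2) d"
      by (rule count_desc_gf) auto
    then show ?thesis
      using Suc unfolding class_gf_def avoiders_eq by (simp add: card_avoiders_Suc gfP_diag)
  qed
qed

text \<open>Clears both denominators of \<open>gam\<close>: that of \<open>tau 0\<close>, and
  \<open>2 - cat\<close> rewritten as \<open>sqr * cat\<close>. Replacing \<open>mu 0\<close>
  cancels the factor \<open>1 - X\<close>.\<close>

lemma gam_closed:
  "gam * (1 - 3 * X + X ^ 2) * sqr * cat ^ 3 =
     (1 - 2 * X) * (1 + X * cat ^ 3) + (1 - X) * X ^ 2 * cat ^ 4 * (cat - 1) -
     X * cat ^ 4 * (1 - 3 * X + X ^ 2)"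
proof -
  have t: "(1 - 3 * X + X ^ 2) * tau 0 = (1 - 2 * X) * mu 0 + X ^ 2 * cat ^ 4 * (cat - 1)"
    using ivd unfolding tau_def power_0 by algebra
  have "cat ^ 2 * (2 - cat) * gam = (1 - X) * tau 0 - X * cat ^ 4"
    using tau_0 cat_eq by algebra
  moreover have "sqr * cat = 2 - cat"
    using cat_eq unfolding sqr_eq by algebra
  ultimately show ?thesis
    using t mu_0 by algebra
qed

theorem theorem2p6:
  fixes z :: "real fps"
  defines "z \<equiv> fps_X"
  shows "class_gf (Av {[4,1,2,3], [1,3,2,4], [3,1,5,2,4]}) =
    (3 - 22 * z + 54 * z^2 - 54 * z^3 + 25 * z^4 - 4 * z^5
       - (1 - 6 * z + 14 * z^2 - 16 * z^3 + 5 * z^4) * fps_sqrt (1 - 4 * z))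
    / (2 * fps_sqrt (1 - 4 * z) * (1 - 3 * z + z^2)^2)"
proof -
  let ?D = "1 - 3 * X + X ^ 2"
  let ?num = "3 - 22 * X + 54 * X^2 - 54 * X^3 + 25 * X^4 - 4 * X^5
       - (1 - 6 * X + 14 * X^2 - 16 * X^3 + 5 * X^4) * sqr"
  \<comment> \<open>In terms of \<open>y\<close> everything is rational:
    \<open>X = y * (1 - y)\<close>, \<open>sqr = 1 - 2 * y\<close>, and \<open>cat\<close> is the
    inverse of \<open>1 - y\<close>.\<close>
  define y where "y = X * cat"
  have cy: "cat * (1 - y) = 1"
    using cat_inv by (simp add: y_def)
  have X: "X = y * (1 - y)"
    using cy unfolding y_def by algebra
  have sqr: "sqr = 1 - 2 * y"
    by (simp add: sqr_eq y_def)
  \<comment> \<open>\<open>G\<close> is \<open>gam * ?D * sqr * cat\<close> with all powers of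
    \<open>cat\<close> cancelled against \<open>1 - y\<close>.\<close>
  define G where "G = (1 - 2 * X) * ((1 - y) ^ 2 + y) - y * (1 + y) - y ^ 4 + 3 * y ^ 2 - X * y ^ 2"
  \<comment> \<open>The inserted factor equals 1 and supplies the \<open>cat ^ 3\<close> of
    \<open>gam_closed\<close>.\<close>
  have "gam * ?D * sqr = (cat * (1 - y)) ^ 3 * (gam * ?D * sqr)"
    by (simp add: cy)
  also have "\<dots> = (1 - y) ^ 3 * ((1 - 2 * X) * (1 + X * cat ^ 3) + (1 - X) * X ^ 2 * cat ^ 4 * (cat - 1) -
     X * cat ^ 4 * ?D)"
    unfolding gam_closed[symmetric] by algebra
  also have "\<dots> = (1 - y) * G"
    using cy y_def unfolding G_def by algebra
  finally have gam: "gam * ?D * sqr = (1 - y) * G" .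
  then have gam_cat: "gam * ?D * sqr * cat = G"
    using cy by algebra
  \<comment> \<open>Eliminating \<open>alp\<close> leaves \<open>gam\<close> only in two products
    already known as polynomials in \<open>X\<close> and \<open>y\<close>.\<close>
  have "(1 + X * (alp + gam * cat ^ 2)) * (2 * sqr * ?D ^ 2) =
      2 * sqr * ?D ^ 2 + 2 * sqr * ?D * (X * (1 - X) - (1 - X) ^ 2 * y) +
      2 * (- (1 - X) * y * (gam * ?D * sqr) + ((1 - X) ^ 2 + ?D) * y * (gam * ?D * sqr * cat))"
    using alp y_def by algebra
  also have "\<dots> = ?num"
    unfolding gam_cat unfolding gam unfolding G_def sqr unfolding X by algebra
  finally have "(1 + X * (alp + gam * cat ^ 2)) * (2 * sqr * ?D ^ 2) = ?num" .
  moreover have "2 * sqr * ?D ^ 2 \<noteq> 0"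
  proof -
    have "sqr \<noteq> 0" "?D \<noteq> 0"
      using sqr_nth_0 ivd by auto
    then show ?thesis by simp
  qed
  ultimately have "1 + X * (alp + gam * cat ^ 2) = ?num / (2 * sqr * ?D ^ 2)"
    by (metis nonzero_mult_div_cancel_right)
  then show ?thesis
    unfolding class_gf_eq z_def sqr_def by simp
qed

end
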